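(* Let $G$ be a finite directed multigraph and $\vec\nu=\langle\nu_e: e\in E(G)\rangle$ an assignment of nonnegative integers to its edges. If $\mathrm{Indeg}_G(x,\nu)=\mathrm{Outdeg}_G(x,\nu)$ at every vertex $x\in V(G)$, then $$|\mathcal{M}_G(\vec\nu)|=\frac{\prod_{x\in V(G)}(\mathrm{Outdeg}_G(x,\nu))!}{\prod_{e\in E(G)}\nu_e!}.$$
   Context: $G$ has vertex set $V(G)$ and edge set $E(G)$, each edge having a tail and a head (loops and parallel edges allowed, edges distinguishable). $\mathrm{Indeg}_G(x,\nu)=\sum_{e:\mathrm{Head}(e)=x}\nu_e$ and $\mathrm{Outdeg}_G(x,\nu)=\sum_{e:\mathrm{Tail}(e)=x}\nu_e$. A cycle in $G$ is a sequence of edges $(e_1,\ldots,e_n)$, $n\ge1$, with $\mathrm{Head}(e_i)=\mathrm{Tail}(e_{i+1})$ (indices mod $n$), considered up to cyclic rotation. Its period is the smallest $p\in\{1,\ldots,n\}$ with $e_i=e_{i+p}$ for all $i$ (indices mod $n$); the cycle is aperiodic if its period equals $n$. $\mathcal{M}_G(\vec\nu)$ is the collection of finite multisets of aperiodic cycles in $G$ in which each edge $e$ is used exactly $\nu_e$ times in total (counting repetitions within cycles and multiplicities of cycles). *)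

theory Defs
  imports Complex_Main "HOL-Library.Multiset" "Graph_Theory.Digraph"
begin

definition weighted_indeg :: "('a, 'b) pre_digraph \<Rightarrow> 'a \<Rightarrow> ('b \<Rightarrow> nat) \<Rightarrow> nat" where
  "weighted_indeg G x \<nu> = (\<Sum>e\<in>in_arcs G x. \<nu> e)"

definition weighted_outdeg :: "('a, 'b) pre_digraph \<Rightarrow> 'a \<Rightarrow> ('b \<Rightarrow> nat) \<Rightarrow> nat" where
  "weighted_outdeg G x \<nu> = (\<Sum>e\<in>out_arcs G x. \<nu> e)"

definition closed_arc_seqs :: "('a, 'b) pre_digraph \<Rightarrow> 'b list set" where
  "closed_arc_seqs G = {es. es \<noteq> [] \<and> set es \<subseteq> arcs G \<and>
     (\<forall>i<length es. head G (es ! i) = tail G (es ! (Suc i mod length es)))}"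

definition rotation_rel :: "('a, 'b) pre_digraph \<Rightarrow> ('b list \<times> 'b list) set" where
  "rotation_rel G = {(es, fs). es \<in> closed_arc_seqs G \<and> fs \<in> closed_arc_seqs G \<and>
     (\<exists>k. fs = rotate k es)}"

text \<open>A cycle is a rotation class of closed arc sequences. Vertices and arcs may repeat
  along it, unlike for the library's \<open>pre_digraph.cycle\<close>.\<close>

definition graph_cycles :: "('a, 'b) pre_digraph \<Rightarrow> 'b list set set" where
  "graph_cycles G = closed_arc_seqs G // rotation_rel G"

definition seq_period :: "'b list \<Rightarrow> nat" where
  "seq_period es = (LEAST p. p \<in> {1..length es} \<and>
     (\<forall>i<length es. es ! i = es ! ((i + p) mod length es)))"

definition aperiodic_cycles :: "('a, 'b) pre_digraph \<Rightarrow> 'b list set set" where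
  "aperiodic_cycles G = {c \<in> graph_cycles G. \<forall>es\<in>c. seq_period es = length es}"

text \<open>All representatives of a cycle use an arc equally often, so the image below is a
  singleton; see \<open>cycle_arc_count_eq\<close>.\<close>

definition cycle_arc_count :: "'b list set \<Rightarrow> 'b \<Rightarrow> nat" where
  "cycle_arc_count c e = the_elem ((\<lambda>es. count_list es e) ` c)"

definition cycle_multisets :: "('a, 'b) pre_digraph \<Rightarrow> ('b \<Rightarrow> nat) \<Rightarrow> 'b list set multiset set" where
  "cycle_multisets G \<nu> = {M. set_mset M \<subseteq> aperiodic_cycles G \<and>
     (\<forall>e\<in>arcs G. (\<Sum>c\<in>#M. cycle_arc_count c e) = \<nu> e)}"

lemma equiv_rotation_rel: "equiv (closed_arc_seqs G) (rotation_rel G)"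
proof (rule equivI)
  show "rotation_rel G \<subseteq> closed_arc_seqs G \<times> closed_arc_seqs G"
    by (auto simp: rotation_rel_def)
  show "refl_on (closed_arc_seqs G) (rotation_rel G)"
    by (auto simp: refl_on_def rotation_rel_def intro: exI[of _ 0])
  show "sym (rotation_rel G)"
  proof (rule symI)
    fix es fs assume "(es, fs) \<in> rotation_rel G"
    then obtain k where k: "fs = rotate k es"
      and C: "es \<in> closed_arc_seqs G" "fs \<in> closed_arc_seqs G"
      by (auto simp: rotation_rel_def)
    have ne: "length es > 0" using C(1) by (simp add: closed_arc_seqs_def)
    have "rotate (length es - k mod length es) fs
        = rotate (length es - k mod length es) (rotate (k mod length es) es)"
      unfolding k by (metis rotate_conv_mod)
    also have "\<dots> = rotate (length es - k mod length es + k mod length es) es"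
      by (simp only: rotate_rotate)
    also have "\<dots> = es"
      using ne by simp
    finally have "es = rotate (length es - k mod length es) fs" by (rule sym)
    with C show "(fs, es) \<in> rotation_rel G"
      unfolding rotation_rel_def by blast
  qed
  show "trans (rotation_rel G)"
  proof (rule transI)
    fix es fs gs assume "(es, fs) \<in> rotation_rel G" "(fs, gs) \<in> rotation_rel G"
    then obtain k l where "fs = rotate k es" "gs = rotate l fs"
      and C: "es \<in> closed_arc_seqs G" "gs \<in> closed_arc_seqs G"
      unfolding rotation_rel_def by blast
    then have "gs = rotate (l + k) es" by (simp only: rotate_rotate)
    with C show "(es, gs) \<in> rotation_rel G"
      unfolding rotation_rel_def by blast
  qed
qed

lemma count_list_rotate: "count_list (rotate k es) e = count_list es e"
proof -
  let ?m = "k mod length es"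
  have "count_list (rotate k es) e = count_list (take ?m es @ drop ?m es) e"
    by (simp only: rotate_drop_take count_list_append add.commute)
  then show ?thesis by (simp only: append_take_drop_id)
qed

lemma cycle_arc_count_eq:
  assumes "c \<in> graph_cycles G" "es \<in> c"
  shows "cycle_arc_count c e = count_list es e"
proof -
  have "count_list fs e = count_list es e" if "fs \<in> c" for fs
  proof -
    have "(es, fs) \<in> rotation_rel G"
      using quotient_eq_iff[OF equiv_rotation_rel, of c G c es fs] assms that
      unfolding graph_cycles_def by blast
    then show ?thesis by (auto simp: rotation_rel_def count_list_rotate)
  qed
  then have "(\<lambda>fs. count_list fs e) ` c = (\<lambda>fs. count_list es e) ` c"
    by (intro image_cong refl)
  also have "\<dots> = {count_list es e}"
    using assms(2) by blast
  finally have "(\<lambda>fs. count_list fs e) ` c = {count_list es e}" .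
  then show ?thesis by (simp add: cycle_arc_count_def)
qed

end

theory Submission
  imports Defs "HOL-Library.FuncSet"
begin

text \<open>
  Split every arc \<open>e\<close> into \<open>\<nu> e\<close> distinguishable copies and consider the permutations \<open>\<sigma>\<close> of
  the copies for which the tail of \<open>\<sigma> a\<close> is the head of \<open>a\<close>. There are
  \<open>\<Prod>x. (Outdeg x)!\<close> of them. Following \<open>\<sigma>\<close> from a copy \<open>a\<close> and forgetting the copy indices
  produces a periodic word; let \<open>f a\<close> be its aperiodic root. Then \<open>f \<circ> \<sigma> = rotate1 \<circ> f\<close>, so
  fibres of \<open>f\<close> over rotations of the same sequence have equal size, and these sizes are the
  multiplicities of a multiset \<open>M\<close> of aperiodic cycles. Conversely \<open>f\<close> is recovered from \<open>\<sigma>\<close>,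
  and \<open>M\<close> from \<open>f\<close>.

  Every \<open>M\<close> arises from exactly \<open>\<Prod>e. (\<nu> e)!\<close> permutations. Given \<open>f\<close> with fibre sizes
  \<open>\<mu> es\<close> prescribed by \<open>M\<close>, there are \<open>\<Prod>es. (\<mu> es)!\<close> choices of \<open>\<sigma>\<close>, which is also the
  number of bijections \<open>g\<close> from \<open>X = {(es, j). j < \<mu> es}\<close> to the copies with \<open>f \<circ> g = fst\<close>.
  So the pairs \<open>(f, \<sigma>)\<close> are as many as the pairs \<open>(f, g)\<close>; as \<open>g\<close> determines \<open>f\<close>, these are
  the bijections \<open>g\<close> sending \<open>(es, j)\<close> to a copy of \<open>hd es\<close>.
\<close>

section \<open>Bijections compatible with two colourings\<close>

text \<open>Using \<open>\<rightarrow>\<^sub>E\<close> fixes the values outside \<open>A\<close>, so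
  for finite \<open>A\<close> and \<open>B\<close> this is a finite set whose cardinality counts the
  bijections themselves.\<close>

definition matching_bijections ::
    "'a set \<Rightarrow> 'b set \<Rightarrow> ('a \<Rightarrow> 'c) \<Rightarrow> ('b \<Rightarrow> 'c) \<Rightarrow> ('a \<Rightarrow> 'b) set" where
  "matching_bijections A B h k =
     {\<sigma> \<in> A \<rightarrow>\<^sub>E B. bij_betw \<sigma> A B \<and> (\<forall>a\<in>A. k (\<sigma> a) = h a)}"

text \<open>The image \<open>b\<close> of the new element is chosen first, and the rest is a
  matching onto \<open>B - {b}\<close>. The inverse resets the value at \<open>a\<close> to
  \<open>undefined\<close> to restore extensionality.\<close>

lemma matching_bijections_insert:
  assumes "a \<notin> A"
  shows "bij_betw (\<lambda>(b, \<tau>). \<tau>(a := b))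
    (SIGMA b:{b \<in> B. k b = h a}. matching_bijections A (B - {b}) h k)
    (matching_bijections (insert a A) B h k)"
proof (rule bij_betw_byWitness[where f' = "\<lambda>\<sigma>. (\<sigma> a, \<sigma>(a := undefined))"])
  show "(\<lambda>(b, \<tau>). \<tau>(a := b)) `
      (SIGMA b:{b \<in> B. k b = h a}. matching_bijections A (B - {b}) h k)
      \<subseteq> matching_bijections (insert a A) B h k"
  proof clarify
    fix b \<tau> assume b: "b \<in> B" "k b = h a" and \<tau>: "\<tau> \<in> matching_bijections A (B - {b}) h k"
    have "bij_betw (\<tau>(a := b)) A (B - {b})"
      using \<tau> assms by (subst bij_betw_cong[where g = \<tau>]) (auto simp: matching_bijections_def)
    then have "bij_betw (\<tau>(a := b)) (insert a A) (insert b (B - {b}))"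
      using assms notIn_Un_bij_betw[of a A "\<tau>(a := b)" "B - {b}"] by simp
    then have "bij_betw (\<tau>(a := b)) (insert a A) B"
      using b by (simp add: insert_absorb)
    moreover have "\<tau>(a := b) \<in> insert a A \<rightarrow>\<^sub>E B"
      using \<tau> b by (auto simp: matching_bijections_def PiE_iff extensional_def)
    ultimately show "\<tau>(a := b) \<in> matching_bijections (insert a A) B h k"
      using \<tau> b assms by (auto simp: matching_bijections_def)
  qed
  show "(\<lambda>\<sigma>. (\<sigma> a, \<sigma>(a := undefined))) ` matching_bijections (insert a A) B h k
      \<subseteq> (SIGMA b:{b \<in> B. k b = h a}. matching_bijections A (B - {b}) h k)"
  proof clarify
    fix \<sigma> assume \<sigma>: "\<sigma> \<in> matching_bijections (insert a A) B h k"
    then have bij: "bij_betw \<sigma> (insert a A) B" by (simp add: matching_bijections_def)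
    have "bij_betw \<sigma> A (B - {\<sigma> a})"
      using bij assms by (auto simp: bij_betw_def inj_on_def)
    then have "bij_betw (\<sigma>(a := undefined)) A (B - {\<sigma> a})"
      using assms by (subst bij_betw_cong[where g = \<sigma>]) auto
    moreover from this have "\<sigma>(a := undefined) \<in> A \<rightarrow>\<^sub>E B - {\<sigma> a}"
      using \<sigma> by (auto simp: matching_bijections_def PiE_iff extensional_def bij_betw_def)
    ultimately show "\<sigma> a \<in> {b \<in> B. k b = h a} \<and>
        \<sigma>(a := undefined) \<in> matching_bijections A (B - {\<sigma> a}) h k"
      using \<sigma> assms by (auto simp: matching_bijections_def)
  qed
qed (use assms in \<open>auto simp: matching_bijections_def PiE_iff extensional_def fun_eq_iff\<close>)

lemma finite_matching_bijections:
  "finite A \<Longrightarrow> finite B \<Longrightarrow> finite (matching_bijections A B h k)"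
  unfolding matching_bijections_def by (rule finite_subset[OF _ finite_PiE[of A "\<lambda>_. B"]]) auto

text \<open>Such a bijection consists of independent bijections between colour classes of equal
  size. The induction removes one element of \<open>A\<close> together with its image, hence
  \<open>B\<close> and \<open>n\<close> vary.\<close>

lemma card_matching_bijections:
  assumes "finite A" "finite B" "finite C" "h ` A \<subseteq> C" "k ` B \<subseteq> C"
    and "\<And>c. c \<in> C \<Longrightarrow> card {a \<in> A. h a = c} = n c"
    and "\<And>c. c \<in> C \<Longrightarrow> card {b \<in> B. k b = c} = n c"
  shows "card (matching_bijections A B h k) = (\<Prod>c\<in>C. fact (n c))"
  using assms
proof (induction A arbitrary: B n rule: finite_induct)
  case empty
  have n0: "n c = 0" if "c \<in> C" for c
    using empty.prems(5)[OF that] by simp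
  have "B = {}"
  proof (rule ccontr)
    assume "B \<noteq> {}"
    then obtain b where "b \<in> B" by blast
    then have "k b \<in> C" "b \<in> {b' \<in> B. k b' = k b}" using empty.prems by auto
    with empty.prems(6)[of "k b"] n0[of "k b"] \<open>finite B\<close> show False by auto
  qed
  then have "matching_bijections {} B h k = {\<lambda>_. undefined}"
    by (auto simp: matching_bijections_def bij_betw_def)
  with n0 show ?case by simp
next
  case (insert a A)
  define c0 where "c0 = h a"
  \<comment> \<open>These are the class sizes after \<open>a\<close> and its image are removed. The
    truncated subtraction is harmless, since \<open>a\<close> itself has colour \<open>c0\<close>
    (\<open>npos\<close>).\<close>
  define n' where "n' = n(c0 := n c0 - 1)"
  have c0: "c0 \<in> C" using insert.prems by (auto simp: c0_def)
  have cA: "card {x \<in> insert a A. h x = c} = card {x \<in> A. h x = c} + (if c = c0 then 1 else 0)" for c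
  proof (cases "c = c0")
    case True
    then have "{x \<in> insert a A. h x = c} = insert a {x \<in> A. h x = c}" by (auto simp: c0_def)
    then show ?thesis using True insert.hyps by simp
  next
    case False
    then have "{x \<in> insert a A. h x = c} = {x \<in> A. h x = c}" by (auto simp: c0_def)
    then show ?thesis using False by simp
  qed
  have npos: "n c0 > 0"
    using cA[of c0] insert.prems(5)[OF c0] by simp
  have IH: "card (matching_bijections A (B - {b}) h k) = (\<Prod>c\<in>C. fact (n' c))"
    if b: "b \<in> B" "k b = c0" for b
  proof (rule insert.IH)
    show "card {a \<in> A. h a = c} = n' c" if "c \<in> C" for c
      using cA[of c] insert.prems(5)[OF that] by (auto simp: n'_def split: if_splits)
    show "card {x \<in> B - {b}. k x = c} = n' c" if "c \<in> C" for c
    proof (cases "c = c0")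
      case True
      then have "{x \<in> B - {b}. k x = c} = {x \<in> B. k x = c} - {b}" by auto
      then show ?thesis using True b insert.prems(6)[OF that] by (simp add: n'_def)
    next
      case False
      then have "{x \<in> B - {b}. k x = c} = {x \<in> B. k x = c}" using b by auto
      then show ?thesis using False insert.prems(6)[OF that] by (simp add: n'_def)
    qed
  qed (use insert.prems in auto)
  have "card (matching_bijections (insert a A) B h k)
      = card (SIGMA b:{b \<in> B. k b = h a}. matching_bijections A (B - {b}) h k)"
    using bij_betw_same_card[OF matching_bijections_insert[OF insert.hyps(2)]] by metis
  also have "\<dots> = (\<Sum>b\<in>{b \<in> B. k b = h a}. card (matching_bijections A (B - {b}) h k))"
    using insert by (intro card_SigmaI) (auto intro: finite_matching_bijections)
  also have "\<dots> = n c0 * (\<Prod>c\<in>C. fact (n' c))"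
    using IH insert.prems(6)[OF c0] by (simp add: c0_def)
  also have "\<dots> = n c0 * (fact (n c0 - 1) * (\<Prod>c\<in>C - {c0}. fact (n c)))"
    using c0 \<open>finite C\<close> by (subst prod.remove[of C c0]) (auto simp: n'_def intro!: prod.cong)
  also have "\<dots> = (\<Prod>c\<in>C. fact (n c))"
    using c0 \<open>finite C\<close> npos by (subst prod.remove[of C c0]) (auto simp: fact_reduce[of "n c0"])
  finally show ?case .
qed

section \<open>Periodic words and aperiodic sequences\<close>

text \<open>The infinite repetition of \<open>es\<close>: rotations become shifts, and sequences of
  different lengths can be compared as functions.\<close>

definition periodic_word :: "'b list \<Rightarrow> nat \<Rightarrow> 'b" where
  "periodic_word es i = es ! (i mod length es)"

lemma periodic_word_rotate:
  assumes "es \<noteq> []"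
  shows "periodic_word (rotate k es) i = periodic_word es (i + k)"
  using assms by (simp add: periodic_word_def nth_rotate mod_simps add.commute)

lemma hd_rotate_eq_periodic_word: "es \<noteq> [] \<Longrightarrow> hd (rotate k es) = periodic_word es k"
  by (simp add: periodic_word_def hd_rotate_conv_nth)

lemma hd_eq_periodic_word: "es \<noteq> [] \<Longrightarrow> hd es = periodic_word es 0"
  by (simp add: periodic_word_def hd_conv_nth)

lemma periodic_word_add_length: "periodic_word es (i + length es) = periodic_word es i"
  by (simp add: periodic_word_def)

lemma periodic_word_shift_iff:
  assumes "es \<noteq> []"
  shows "(\<forall>i. periodic_word es (i + q) = periodic_word es i) \<longleftrightarrow>
    (\<forall>i<length es. es ! i = es ! ((i + q) mod length es))"
proof
  assume R: "\<forall>i<length es. es ! i = es ! ((i + q) mod length es)"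
  show "\<forall>i. periodic_word es (i + q) = periodic_word es i"
  proof
    fix i
    have "i mod length es < length es" using assms by simp
    from R[rule_format, OF this] show "periodic_word es (i + q) = periodic_word es i"
      by (simp add: periodic_word_def mod_simps)
  qed
next
  assume L: "\<forall>i. periodic_word es (i + q) = periodic_word es i"
  show "\<forall>i<length es. es ! i = es ! ((i + q) mod length es)"
  proof (intro allI impI)
    fix i assume "i < length es"
    with L[rule_format, of i] show "es ! i = es ! ((i + q) mod length es)"
      by (simp add: periodic_word_def)
  qed
qed

text \<open>The length always satisfies the condition under the \<open>LEAST\<close>, so it is the
  least such number exactly when no smaller positive one works.\<close>

lemma seq_period_eq_length_iff:
  assumes "es \<noteq> []"
  shows "seq_period es = length es \<longleftrightarrow>
    (\<forall>q. 0 < q \<and> q < length es \<longrightarrow> \<not> (\<forall>i. periodic_word es (i + q) = periodic_word es i))"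
    (is "_ \<longleftrightarrow> ?R")
proof
  assume *: "seq_period es = length es"
  show ?R
  proof (intro allI impI)
    fix q assume "0 < q \<and> q < length es"
    then show "\<not> (\<forall>i. periodic_word es (i + q) = periodic_word es i)"
      using not_less_Least[of q "\<lambda>p. p \<in> {1..length es} \<and>
         (\<forall>i<length es. es ! i = es ! ((i + p) mod length es))"] *
      unfolding periodic_word_shift_iff[OF assms] seq_period_def by auto
  qed
next
  assume R: ?R
  show "seq_period es = length es"
    unfolding seq_period_def
  proof (rule Least_equality)
    show "length es \<in> {1..length es} \<and>
        (\<forall>i<length es. es ! i = es ! ((i + length es) mod length es))"
      using assms by (simp add: Suc_le_eq)
  next
    fix q assume q: "q \<in> {1..length es} \<and>
        (\<forall>i<length es. es ! i = es ! ((i + q) mod length es))"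
    then have "\<forall>i. periodic_word es (i + q) = periodic_word es i"
      using periodic_word_shift_iff[OF assms] by blast
    with R q show "length es \<le> q"
      by (metis atLeastAtMost_iff le_simps(3) linorder_not_le One_nat_def)
  qed
qed

text \<open>Uniqueness of the aperiodic root: each length is a period of the common word, so
  aperiodicity bounds each length by the other.\<close>

lemma periodic_word_inject:
  assumes "es \<noteq> []" "fs \<noteq> []" "seq_period es = length es" "seq_period fs = length fs"
    and "periodic_word es = periodic_word fs"
  shows "es = fs"
proof -
  have le: "length es \<le> length fs"
    if "es \<noteq> []" "fs \<noteq> []" "seq_period es = length es" "periodic_word es = periodic_word fs"
    for es fs :: "'b list"
  proof (rule ccontr)
    assume "\<not> length es \<le> length fs"
    moreover have "\<forall>i. periodic_word es (i + length fs) = periodic_word es i"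
      using that(4) by (simp add: periodic_word_add_length)
    ultimately show False
      using that seq_period_eq_length_iff[of es] by auto
  qed
  have "length es = length fs"
    using le[of es fs] le[of fs es] assms by simp
  moreover have "es ! i = fs ! i" if "i < length es" for i
    using fun_cong[OF assms(5), of i] that \<open>length es = length fs\<close>
    by (simp add: periodic_word_def)
  ultimately show ?thesis by (rule nth_equalityI)
qed

text \<open>A period of a shifted word is a period of the word, because a shift can be undone by
  moving on to a multiple of the length.\<close>

lemma seq_period_rotate:
  assumes "es \<noteq> []" "seq_period es = length es"
  shows "seq_period (rotate k es) = length es"
proof -
  have "\<not> (\<forall>i. periodic_word es (i + q + k) = periodic_word es (i + k))"
    if "0 < q" "q < length es" for q
  proof
    assume *: "\<forall>i. periodic_word es (i + q + k) = periodic_word es (i + k)"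
    have "periodic_word es (i + q) = periodic_word es i" for i
    proof -
      \<comment> \<open>A multiple of the length that is at least \<open>k\<close>: moving forward
        by \<open>length es * k - k\<close> serves as a shift back by \<open>k\<close>.\<close>
      have len: "length es * k - k + k = length es * k"
        using assms(1) by (cases es) auto
      have "periodic_word es (i + q) = periodic_word es (i + q + length es * k)"
        by (simp add: periodic_word_def)
      also have "\<dots> = periodic_word es ((i + (length es * k - k)) + q + k)"
        using len by (metis add.assoc add.commute)
      also have "\<dots> = periodic_word es (i + (length es * k - k) + k)"
        using * by blast
      also have "\<dots> = periodic_word es (i + length es * k)"
        using len by (metis add.assoc)
      also have "\<dots> = periodic_word es i"
        by (simp add: periodic_word_def)
      finally show ?thesis .
    qed
    then show False
      using that assms seq_period_eq_length_iff[OF assms(1)] by blast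
  qed
  then have "seq_period (rotate k es) = length (rotate k es)"
    using assms(1) by (subst seq_period_eq_length_iff) (auto simp: periodic_word_rotate)
  then show ?thesis by simp
qed

text \<open>Two coinciding rotations by \<open>j < k\<close> would give the period
  \<open>k - j\<close>, which is smaller than the length.\<close>

lemma inj_on_rotate:
  assumes "es \<noteq> []" "seq_period es = length es"
  shows "inj_on (\<lambda>k. rotate k es) {..<length es}"
proof -
  have ne: "rotate j es \<noteq> rotate k es" if "j < k" "k < length es" for j k
  proof
    assume eq: "rotate j es = rotate k es"
    have "rotate (k - j) (rotate j es) = rotate (k - j + j) es"
      by (simp only: rotate_rotate)
    also have "\<dots> = rotate j es"
      using eq that by simp
    finally have "rotate (k - j) (rotate j es) = rotate j es" .
    then have "periodic_word (rotate j es) (i + (k - j)) = periodic_word (rotate j es) i" for i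
      using periodic_word_rotate[of "rotate j es" "k - j" i] assms(1) by simp
    then show False
      using seq_period_rotate[OF assms, of j] seq_period_eq_length_iff[of "rotate j es"] assms(1) that
      by (metis length_rotate less_imp_diff_less rotate_is_Nil_conv zero_less_diff)
  qed
  show ?thesis
    by (rule inj_onI) (metis ne lessThan_iff linorder_neqE_nat)
qed

text \<open>The root consists of the first \<open>q\<close> letters for the least period
  \<open>q\<close> of \<open>w\<close>; a smaller period of the root would again be a period of
  \<open>w\<close>.\<close>

lemma ex_aperiodic_root:
  fixes w :: "nat \<Rightarrow> 'b"
  assumes "p > 0" "\<And>i. w (i + p) = w i"
  obtains es where "es \<noteq> []" "seq_period es = length es" "periodic_word es = w"
proof -
  define q where "q = (LEAST q. q > 0 \<and> (\<forall>i. w (i + q) = w i))"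
  have q: "q > 0" "w (i + q) = w i" for i
    using LeastI[of "\<lambda>q. q > 0 \<and> (\<forall>i. w (i + q) = w i)" p] assms by (auto simp: q_def)
  have least: "q \<le> r" if "r > 0" "\<forall>i. w (i + r) = w i" for r
    unfolding q_def using that by (intro Least_le) blast
  have mult: "w (i + q * m) = w i" for i m
  proof (induction m)
    case (Suc m)
    have "w (i + q * Suc m) = w (i + q * m + q)" by (simp add: algebra_simps)
    with Suc q show ?case by simp
  qed simp
  define es where "es = map w [0..<q]"
  have "w (i mod q) = w i" for i
    using mult[of "i mod q" "i div q"] by simp
  then have pw: "periodic_word es = w"
    using q(1) by (intro ext) (simp add: periodic_word_def es_def)
  have ne: "es \<noteq> []" using q by (simp add: es_def)
  have "seq_period es = length es"
    unfolding seq_period_eq_length_iff[OF ne] pw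
  proof (intro allI impI notI)
    fix r assume "0 < r \<and> r < length es" "\<forall>i. w (i + r) = w i"
    with least[of r] show False by (simp add: es_def)
  qed
  with ne show thesis using pw by (rule that)
qed

section \<open>Aperiodic cycles\<close>

text \<open>With a condition on all positions of the periodic word, invariance under rotation
  becomes immediate.\<close>

lemma closed_arc_seqs_iff:
  "es \<in> closed_arc_seqs G \<longleftrightarrow> es \<noteq> [] \<and> (\<forall>i. periodic_word es i \<in> arcs G) \<and>
    (\<forall>i. head G (periodic_word es i) = tail G (periodic_word es (Suc i)))"
proof (cases "es = []")
  case False
  have "set es \<subseteq> arcs G \<longleftrightarrow> (\<forall>i. periodic_word es i \<in> arcs G)"
  proof
    assume R: "\<forall>i. periodic_word es i \<in> arcs G"
    show "set es \<subseteq> arcs G"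
    proof
      fix e assume "e \<in> set es"
      then obtain i where "i < length es" "e = es ! i" by (auto simp: in_set_conv_nth)
      with R[rule_format, of i] show "e \<in> arcs G" by (simp add: periodic_word_def)
    qed
  qed (use False in \<open>auto simp: periodic_word_def\<close>)
  moreover have "(\<forall>i<length es. head G (es ! i) = tail G (es ! (Suc i mod length es))) \<longleftrightarrow>
    (\<forall>i. head G (periodic_word es i) = tail G (periodic_word es (Suc i)))"
  proof
    assume L: "\<forall>i<length es. head G (es ! i) = tail G (es ! (Suc i mod length es))"
    show "\<forall>i. head G (periodic_word es i) = tail G (periodic_word es (Suc i))"
    proof
      fix i
      have "i mod length es < length es" using False by simp
      from L[rule_format, OF this]
      show "head G (periodic_word es i) = tail G (periodic_word es (Suc i))"
        by (simp add: periodic_word_def mod_simps)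
    qed
  next
    assume R: "\<forall>i. head G (periodic_word es i) = tail G (periodic_word es (Suc i))"
    show "\<forall>i<length es. head G (es ! i) = tail G (es ! (Suc i mod length es))"
    proof (intro allI impI)
      fix i assume "i < length es"
      with R[rule_format, of i] show "head G (es ! i) = tail G (es ! (Suc i mod length es))"
        by (simp add: periodic_word_def)
    qed
  qed
  ultimately show ?thesis using False by (simp add: closed_arc_seqs_def)
qed (simp add: closed_arc_seqs_def)

lemma rotate_closed_arc_seqs: "es \<in> closed_arc_seqs G \<Longrightarrow> rotate k es \<in> closed_arc_seqs G"
  by (simp add: closed_arc_seqs_iff periodic_word_rotate)

text \<open>Aperiodic cycles with a chosen starting arc; an aperiodic cycle of length
  \<open>n\<close> yields \<open>n\<close> of them.\<close>

definition aperiodic_seqs :: "('a, 'b) pre_digraph \<Rightarrow> 'b list set" where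
  "aperiodic_seqs G = {es \<in> closed_arc_seqs G. seq_period es = length es}"

definition rotation_class :: "('a, 'b) pre_digraph \<Rightarrow> 'b list \<Rightarrow> 'b list set" where
  "rotation_class G es = rotation_rel G `` {es}"

lemma aperiodic_seqs_nonempty: "es \<in> aperiodic_seqs G \<Longrightarrow> es \<noteq> []"
  by (auto simp: aperiodic_seqs_def closed_arc_seqs_def)

lemma rotate_aperiodic_seqs: "es \<in> aperiodic_seqs G \<Longrightarrow> rotate k es \<in> aperiodic_seqs G"
  using aperiodic_seqs_nonempty[of es G]
  by (auto simp: aperiodic_seqs_def rotate_closed_arc_seqs seq_period_rotate)

lemma rotate1_aperiodic_seqs: "es \<in> aperiodic_seqs G \<Longrightarrow> rotate1 es \<in> aperiodic_seqs G"
  using rotate_aperiodic_seqs[of es G 1] by simp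

lemma rotation_class_eq:
  assumes "es \<in> closed_arc_seqs G"
  shows "rotation_class G es = (\<lambda>k. rotate k es) ` {..<length es}"
proof -
  have "length es > 0" using assms by (auto simp: closed_arc_seqs_def)
  then have "\<exists>l<length es. rotate k es = rotate l es" for k
    by (metis mod_less_divisor rotate_conv_mod)
  then show ?thesis
    using assms rotate_closed_arc_seqs[OF assms]
    by (auto simp: rotation_class_def rotation_rel_def image_iff)
qed

lemma rotation_class_rotate1:
  assumes "es \<in> closed_arc_seqs G"
  shows "rotation_class G (rotate1 es) = rotation_class G es"
proof -
  have "(es, rotate 1 es) \<in> rotation_rel G"
    using assms rotate_closed_arc_seqs[OF assms] unfolding rotation_rel_def by blast
  then show ?thesis
    unfolding rotation_class_def using equiv_class_eq[OF equiv_rotation_rel] by fastforce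
qed

lemma rotation_class_self: "es \<in> closed_arc_seqs G \<Longrightarrow> es \<in> rotation_class G es"
  unfolding rotation_class_def by (rule equiv_class_self[OF equiv_rotation_rel])

lemma rotation_class_mem_aperiodic_cycles:
  assumes "es \<in> aperiodic_seqs G"
  shows "rotation_class G es \<in> aperiodic_cycles G"
proof -
  have es: "es \<in> closed_arc_seqs G" "es \<noteq> []" "seq_period es = length es"
    using assms aperiodic_seqs_nonempty[OF assms] by (auto simp: aperiodic_seqs_def)
  have "rotation_class G es \<in> graph_cycles G"
    unfolding rotation_class_def graph_cycles_def using es(1) by (rule quotientI)
  then show ?thesis
    using es by (auto simp: aperiodic_cycles_def rotation_class_eq seq_period_rotate)
qed

text \<open>Allows any representative to stand for its cycle; in particular, distinct cycles are
  disjoint.\<close>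

lemma mem_aperiodic_cycle:
  assumes "c \<in> aperiodic_cycles G" "es \<in> c"
  shows "es \<in> aperiodic_seqs G" "rotation_class G es = c"
proof -
  from assms obtain fs where fs: "fs \<in> closed_arc_seqs G" "c = rotation_rel G `` {fs}"
    by (auto simp: aperiodic_cycles_def graph_cycles_def elim: quotientE)
  with assms(2) have *: "(fs, es) \<in> rotation_rel G" by simp
  then have "es \<in> closed_arc_seqs G" by (simp add: rotation_rel_def)
  with assms show "es \<in> aperiodic_seqs G" by (auto simp: aperiodic_seqs_def aperiodic_cycles_def)
  show "rotation_class G es = c"
    unfolding rotation_class_def fs(2) using equiv_class_eq[OF equiv_rotation_rel *] by simp
qed

lemma aperiodic_cycle_nonempty: "c \<in> aperiodic_cycles G \<Longrightarrow> c \<noteq> {}"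
  unfolding aperiodic_cycles_def graph_cycles_def
  using in_quotient_imp_non_empty[OF equiv_rotation_rel] by blast

lemma finite_aperiodic_cycle:
  assumes "c \<in> aperiodic_cycles G"
  shows "finite c"
proof -
  obtain es where "es \<in> c" using aperiodic_cycle_nonempty[OF assms] by blast
  from mem_aperiodic_cycle[OF assms this] show ?thesis
    using rotation_class_eq[of es G] by (auto simp: aperiodic_seqs_def)
qed

text \<open>The rotation by \<open>k\<close> starts with \<open>es ! k\<close>, and aperiodicity
  makes the rotations distinct. Occurrences of \<open>e\<close> therefore correspond to the
  representatives that start with \<open>e\<close>.\<close>

lemma cycle_arc_count_eq_card:
  assumes c: "c \<in> aperiodic_cycles G"
  shows "cycle_arc_count c e = card {es \<in> c. hd es = e}"
proof -
  obtain es where es: "es \<in> c" using aperiodic_cycle_nonempty[OF assms] by blast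
  note es' = mem_aperiodic_cycle[OF c es]
  have ne: "es \<noteq> []" using es'(1) by (rule aperiodic_seqs_nonempty)
  have inj: "inj_on (\<lambda>k. rotate k es) {..<length es}"
    using es'(1) ne by (intro inj_on_rotate) (auto simp: aperiodic_seqs_def)
  have "c = (\<lambda>k. rotate k es) ` {..<length es}"
    using es' rotation_class_eq[of es G] by (auto simp: aperiodic_seqs_def)
  then have "{fs \<in> c. hd fs = e} = (\<lambda>k. rotate k es) ` {k \<in> {..<length es}. es ! k = e}"
    using ne by (auto simp: hd_rotate_conv_nth)
  then have "card {fs \<in> c. hd fs = e} = card {k \<in> {..<length es}. es ! k = e}"
    using inj by (auto intro!: card_image intro: inj_on_subset)
  also have "\<dots> = count_list es e"
    by (simp add: count_list_eq_length_filter length_filter_conv_card eq_commute)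
  finally show ?thesis
    using cycle_arc_count_eq[of c G es e] es c by (simp add: aperiodic_cycles_def)
qed

lemma sum_mset_eq_sum_count:
  fixes f :: "'a \<Rightarrow> nat"
  assumes "finite A" "set_mset M \<subseteq> A"
  shows "(\<Sum>x\<in>#M. f x) = (\<Sum>x\<in>A. count M x * f x)"
  using assms(2)
proof (induction M)
  case (add y M)
  have "(\<Sum>x\<in>A. count (add_mset y M) x * f x) =
      (\<Sum>x\<in>A. count M x * f x + (if x = y then f x else 0))"
    by (intro sum.cong) auto
  also have "\<dots> = (\<Sum>x\<in>A. count M x * f x) + f y"
    using add.prems assms(1) by (simp add: sum.distrib)
  finally show ?case using add by simp
qed simp

text \<open>Passes from cycles to their representatives, so that the usage of \<open>e\<close>
  becomes a sum of the multiplicities that serve as fibre sizes of labellings.\<close>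

lemma sum_cycle_arc_count:
  assumes "set_mset M \<subseteq> aperiodic_cycles G"
  shows "(\<Sum>c\<in>#M. cycle_arc_count c e) =
    (\<Sum>es\<in>{es \<in> \<Union> (set_mset M). hd es = e}. count M (rotation_class G es))"
proof -
  have "(\<Sum>c\<in>#M. cycle_arc_count c e) = (\<Sum>c\<in>set_mset M. count M c * cycle_arc_count c e)"
    by (rule sum_mset_eq_sum_count) auto
  also have "\<dots> = (\<Sum>c\<in>set_mset M. \<Sum>es\<in>{es \<in> c. hd es = e}. count M (rotation_class G es))"
  proof (rule sum.cong[OF refl])
    fix c assume "c \<in># M"
    then have c: "c \<in> aperiodic_cycles G" using assms by blast
    have "(\<Sum>es\<in>{es \<in> c. hd es = e}. count M (rotation_class G es)) = (\<Sum>es\<in>{es \<in> c. hd es = e}. count M c)"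
      using mem_aperiodic_cycle(2)[OF c] by (intro sum.cong) auto
    then show "count M c * cycle_arc_count c e =
        (\<Sum>es\<in>{es \<in> c. hd es = e}. count M (rotation_class G es))"
      by (simp add: cycle_arc_count_eq_card[OF c])
  qed
  also have "\<dots> = (\<Sum>es\<in>(\<Union>c\<in>set_mset M. {es \<in> c. hd es = e}). count M (rotation_class G es))"
  proof (rule sum.UNION_disjoint[symmetric])
    show "\<forall>c\<in>set_mset M. \<forall>d\<in>set_mset M. c \<noteq> d \<longrightarrow>
        {es \<in> c. hd es = e} \<inter> {es \<in> d. hd es = e} = {}"
      using mem_aperiodic_cycle(2) assms by blast
    show "\<forall>c\<in>set_mset M. finite {es \<in> c. hd es = e}"
    proof
      fix c assume "c \<in># M"
      with assms have "finite c" using finite_aperiodic_cycle by blast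
      then show "finite {es \<in> c. hd es = e}" by simp
    qed
  qed (rule finite_set_mset)
  also have "(\<Union>c\<in>set_mset M. {es \<in> c. hd es = e}) = {es \<in> \<Union> (set_mset M). hd es = e}"
    by blast
  finally show ?thesis .
qed

section \<open>Labelled arc copies\<close>

text \<open>By the pigeonhole principle two iterates of \<open>a\<close> coincide, and the earlier
  power can be cancelled because it is injective.\<close>

lemma ex_funpow_fixpoint:
  assumes "finite A" "bij_betw \<sigma> A A" "a \<in> A"
  obtains p where "p > 0" "(\<sigma> ^^ p) a = a"
proof -
  have bij: "bij_betw (\<sigma> ^^ i) A A" for i
    using assms(2) by (rule bij_betw_funpow)
  then have mem: "(\<sigma> ^^ i) a \<in> A" for i
    using assms(3) by (auto simp: bij_betw_def)
  have "\<not> inj (\<lambda>i. (\<sigma> ^^ i) a)"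
  proof
    assume "inj (\<lambda>i. (\<sigma> ^^ i) a)"
    moreover have "finite (range (\<lambda>i. (\<sigma> ^^ i) a))"
      using mem by (intro finite_subset[OF _ assms(1)]) auto
    ultimately show False using finite_imageD infinite_UNIV_nat by blast
  qed
  then obtain i j where "i < j" "(\<sigma> ^^ i) a = (\<sigma> ^^ j) a"
    unfolding inj_on_def by (metis linorder_neqE_nat)
  moreover from this have "(\<sigma> ^^ j) a = (\<sigma> ^^ i) ((\<sigma> ^^ (j - i)) a)"
    by (metis comp_apply funpow_add le_add_diff_inverse less_imp_le)
  ultimately have "(\<sigma> ^^ (j - i)) a = a"
    using bij_betw_imp_inj_on[OF bij[of i]] mem[of "j - i"] assms(3)
    by (metis inj_onD)
  with \<open>i < j\<close> show thesis by (intro that[of "j - i"]) auto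
qed

section \<open>Arc copies, their labellings and their permutations\<close>

definition arc_copies :: "('a, 'b) pre_digraph \<Rightarrow> ('b \<Rightarrow> nat) \<Rightarrow> ('b \<times> nat) set" where
  "arc_copies G \<nu> = (SIGMA e:arcs G. {..<\<nu> e})"

text \<open>The candidates for the map \<open>f\<close>, described without a permutation: every
  representative of a cycle labels as many copies as the multiplicity of that cycle in
  \<open>M\<close>.\<close>

definition arc_labellings ::
    "('a, 'b) pre_digraph \<Rightarrow> ('b \<Rightarrow> nat) \<Rightarrow> 'b list set multiset \<Rightarrow> ('b \<times> nat \<Rightarrow> 'b list) set" where
  "arc_labellings G \<nu> M = {f \<in> arc_copies G \<nu> \<rightarrow>\<^sub>E aperiodic_seqs G.
     (\<forall>a\<in>arc_copies G \<nu>. hd (f a) = fst a) \<and>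
     (\<forall>es\<in>aperiodic_seqs G. card {a \<in> arc_copies G \<nu>. f a = es} = count M (rotation_class G es))}"

text \<open>This set and \<open>rotating_bijections\<close> are both colour matchings, with vertices
  and with sequences as colours, so one lemma counts both.\<close>

abbreviation arc_successions ::
    "('a, 'b) pre_digraph \<Rightarrow> ('b \<Rightarrow> nat) \<Rightarrow> ('b \<times> nat \<Rightarrow> 'b \<times> nat) set" where
  "arc_successions G \<nu> \<equiv>
     matching_bijections (arc_copies G \<nu>) (arc_copies G \<nu>) (\<lambda>a. head G (fst a)) (\<lambda>a. tail G (fst a))"

abbreviation rotating_bijections ::
    "('a, 'b) pre_digraph \<Rightarrow> ('b \<Rightarrow> nat) \<Rightarrow> ('b \<times> nat \<Rightarrow> 'b list) \<Rightarrow> ('b \<times> nat \<Rightarrow> 'b \<times> nat) set" where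
  "rotating_bijections G \<nu> f \<equiv>
     matching_bijections (arc_copies G \<nu>) (arc_copies G \<nu>) (\<lambda>a. rotate1 (f a)) f"

lemma finite_arc_copies: "finite (arcs G) \<Longrightarrow> finite (arc_copies G \<nu>)"
  by (auto simp: arc_copies_def)

lemma card_arc_copies_tail:
  assumes "finite (arcs G)"
  shows "card {a \<in> arc_copies G \<nu>. tail G (fst a) = x} = weighted_outdeg G x \<nu>"
proof -
  have "{a \<in> arc_copies G \<nu>. tail G (fst a) = x} = (SIGMA e:out_arcs G x. {..<\<nu> e})"
    by (auto simp: arc_copies_def out_arcs_def)
  moreover have "finite (out_arcs G x)" using assms by (simp add: out_arcs_def)
  ultimately show ?thesis by (simp add: weighted_outdeg_def)
qed

lemma card_arc_copies_head:
  assumes "finite (arcs G)"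
  shows "card {a \<in> arc_copies G \<nu>. head G (fst a) = x} = weighted_indeg G x \<nu>"
proof -
  have "{a \<in> arc_copies G \<nu>. head G (fst a) = x} = (SIGMA e:in_arcs G x. {..<\<nu> e})"
    by (auto simp: arc_copies_def in_arcs_def)
  moreover have "finite (in_arcs G x)" using assms by (simp add: in_arcs_def)
  ultimately show ?thesis by (simp add: weighted_indeg_def)
qed

lemma card_arc_copies_fst:
  assumes "e \<in> arcs G"
  shows "card {a \<in> arc_copies G \<nu>. fst a = e} = \<nu> e"
proof -
  have "{a \<in> arc_copies G \<nu>. fst a = e} = {e} \<times> {..<\<nu> e}"
    using assms by (auto simp: arc_copies_def)
  then show ?thesis by simp
qed

text \<open>At a vertex \<open>x\<close> the two colour classes have the indegree and the outdegree
  as sizes; the balance condition makes them equal.\<close>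

lemma card_arc_successions:
  assumes "fin_digraph G"
    and "\<And>x. x \<in> verts G \<Longrightarrow> weighted_indeg G x \<nu> = weighted_outdeg G x \<nu>"
  shows "card (arc_successions G \<nu>) = (\<Prod>x\<in>verts G. fact (weighted_outdeg G x \<nu>))"
proof -
  interpret fin_digraph G by (rule assms(1))
  show ?thesis
  proof (rule card_matching_bijections)
    show "(\<lambda>a. head G (fst a)) ` arc_copies G \<nu> \<subseteq> verts G"
      "(\<lambda>a. tail G (fst a)) ` arc_copies G \<nu> \<subseteq> verts G"
      by (auto simp: arc_copies_def)
  qed (use assms(2) in
        \<open>simp_all add: finite_arc_copies card_arc_copies_tail card_arc_copies_head\<close>)
qed

section \<open>The multiset belonging to a labelling\<close>

text \<open>A sequence occurs as a label exactly when its fibre is nonempty, that is, when its class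
  has positive multiplicity.\<close>

lemma arc_labellings_image:
  assumes "finite (arcs G)" "set_mset M \<subseteq> aperiodic_cycles G" "f \<in> arc_labellings G \<nu> M"
  shows "f ` arc_copies G \<nu> = \<Union> (set_mset M)"
proof -
  have P: "f a \<in> aperiodic_seqs G" if "a \<in> arc_copies G \<nu>" for a
    using assms(3) that by (auto simp: arc_labellings_def)
  have cnt: "card {a \<in> arc_copies G \<nu>. f a = es} = count M (rotation_class G es)"
    if "es \<in> aperiodic_seqs G" for es
    using assms(3) that by (auto simp: arc_labellings_def)
  have fin: "finite {a \<in> arc_copies G \<nu>. f a = es}" for es
    using finite_arc_copies[OF assms(1)] by simp
  show ?thesis
  proof (intro equalityI subsetI)
    fix es assume "es \<in> f ` arc_copies G \<nu>"
    then obtain a where a: "a \<in> arc_copies G \<nu>" "f a = es" by blast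
    then have es: "es \<in> aperiodic_seqs G" using P by blast
    have "card {a \<in> arc_copies G \<nu>. f a = es} \<noteq> 0"
      using a by (subst card_0_eq[OF fin]) blast
    then have "rotation_class G es \<in># M" using cnt[OF es] by simp
    moreover have "es \<in> rotation_class G es"
      using es by (intro rotation_class_self) (simp add: aperiodic_seqs_def)
    ultimately show "es \<in> \<Union> (set_mset M)" by blast
  next
    fix es assume "es \<in> \<Union> (set_mset M)"
    then obtain c where c: "c \<in># M" "es \<in> c" by blast
    with assms(2) have "c \<in> aperiodic_cycles G" by blast
    note es = mem_aperiodic_cycle[OF this c(2)]
    have "card {a \<in> arc_copies G \<nu>. f a = es} \<noteq> 0" using cnt es c by simp
    then have "{a \<in> arc_copies G \<nu>. f a = es} \<noteq> {}" by (metis card.empty)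
    then show "es \<in> f ` arc_copies G \<nu>" by blast
  qed
qed

text \<open>Sorting the \<open>\<nu> e\<close> copies of \<open>e\<close> by label gives a sum of
  multiplicities over the representatives starting with \<open>e\<close>, which is the usage of
  \<open>e\<close> in \<open>M\<close>.\<close>

lemma arc_labellings_imp_cycle_multisets:
  assumes "finite (arcs G)" "set_mset M \<subseteq> aperiodic_cycles G" "f \<in> arc_labellings G \<nu> M"
  shows "M \<in> cycle_multisets G \<nu>"
proof -
  have hd: "hd (f a) = fst a" if "a \<in> arc_copies G \<nu>" for a
    using assms(3) that by (auto simp: arc_labellings_def)
  have "(\<Sum>c\<in>#M. cycle_arc_count c e) = \<nu> e" if e: "e \<in> arcs G" for e
  proof -
    let ?S = "{a \<in> arc_copies G \<nu>. fst a = e}"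
    have img: "f ` ?S = {es \<in> \<Union> (set_mset M). hd es = e}"
      using hd by (auto simp flip: arc_labellings_image[OF assms])
    have "card ?S = (\<Sum>es\<in>f ` ?S. card {a \<in> ?S. f a = es})"
      using sum.image_gen[of ?S "\<lambda>_. 1::nat" f] finite_arc_copies[OF assms(1)] by simp
    also have "\<dots> = (\<Sum>es\<in>f ` ?S. count M (rotation_class G es))"
    proof (rule sum.cong[OF refl])
      fix es assume es: "es \<in> f ` ?S"
      then have "hd es = e" using img by simp
      \<comment> \<open>A label that starts with \<open>e\<close> is carried by copies of
        \<open>e\<close> only, so the restriction to \<open>?S\<close> loses nothing of the
        fibre.\<close>
      then have "{a \<in> ?S. f a = es} = {a \<in> arc_copies G \<nu>. f a = es}"
        using hd by fastforce
      moreover have "es \<in> aperiodic_seqs G"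
        using es assms(3) by (auto simp: arc_labellings_def)
      ultimately show "card {a \<in> ?S. f a = es} = count M (rotation_class G es)"
        using assms(3) by (simp add: arc_labellings_def)
    qed
    finally show ?thesis
      using card_arc_copies_fst[OF e, of \<nu>] sum_cycle_arc_count[OF assms(2)] img by simp
  qed
  with assms(2) show ?thesis by (simp add: cycle_multisets_def)
qed

section \<open>Counting the permutations compatible with a labelling\<close>

lemma finite_Union_cycles:
  "set_mset M \<subseteq> aperiodic_cycles G \<Longrightarrow> finite (\<Union> (set_mset M))"
  by (intro finite_Union finite_set_mset) (blast intro: finite_aperiodic_cycle)

lemma mem_Union_cycles_iff:
  assumes "set_mset M \<subseteq> aperiodic_cycles G"
  shows "es \<in> \<Union> (set_mset M) \<longleftrightarrow> es \<in> aperiodic_seqs G \<and> rotation_class G es \<in># M"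
proof
  assume "es \<in> \<Union> (set_mset M)"
  then show "es \<in> aperiodic_seqs G \<and> rotation_class G es \<in># M"
    using assms mem_aperiodic_cycle by blast
next
  assume *: "es \<in> aperiodic_seqs G \<and> rotation_class G es \<in># M"
  then have "es \<in> rotation_class G es"
    by (intro rotation_class_self) (simp add: aperiodic_seqs_def)
  with * show "es \<in> \<Union> (set_mset M)" by blast
qed

text \<open>Rotation by one less than the length inverts \<open>rotate1\<close> and stays in the
  class. Fibres of the rotated labelling are thereby reduced to fibres of \<open>f\<close>.\<close>

lemma rotate1_preimage:
  assumes "es \<in> aperiodic_seqs G"
  obtains es' where "es' \<in> aperiodic_seqs G" "rotate1 es' = es"
    "rotation_class G es' = rotation_class G es"
proof -
  define es' where "es' = rotate (length es - 1) es"
  have P: "es' \<in> aperiodic_seqs G"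
    using assms by (simp add: es'_def rotate_aperiodic_seqs)
  have "rotate1 es' = rotate (Suc (length es - 1)) es"
    by (simp add: es'_def)
  also have "\<dots> = es"
    using aperiodic_seqs_nonempty[OF assms] by (cases es) (simp_all del: rotate_Suc)
  finally have "rotate1 es' = es" .
  with P show thesis
    using rotation_class_rotate1[of es' G] by (intro that) (auto simp: aperiodic_seqs_def)
qed

text \<open>The fibres of \<open>f\<close> and of its rotation over \<open>es\<close> have the same
  size, as \<open>es\<close> and its predecessor under \<open>rotate1\<close> lie in one class. The
  resulting product depends on \<open>M\<close> but not on \<open>f\<close>.\<close>

lemma card_rotating_bijections:
  assumes "finite (arcs G)" "set_mset M \<subseteq> aperiodic_cycles G" "f \<in> arc_labellings G \<nu> M"
  shows "card (rotating_bijections G \<nu> f) =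
    (\<Prod>es\<in>\<Union> (set_mset M). fact (count M (rotation_class G es)))"
proof (rule card_matching_bijections)
  have cnt: "card {a \<in> arc_copies G \<nu>. f a = es} = count M (rotation_class G es)"
    if "es \<in> aperiodic_seqs G" for es
    using assms(3) that by (auto simp: arc_labellings_def)
  show "card {a \<in> arc_copies G \<nu>. f a = es} = count M (rotation_class G es)"
    if "es \<in> \<Union> (set_mset M)" for es
    using that cnt unfolding mem_Union_cycles_iff[OF assms(2)] by blast
  show "card {a \<in> arc_copies G \<nu>. rotate1 (f a) = es} = count M (rotation_class G es)"
    if "es \<in> \<Union> (set_mset M)" for es
  proof -
    have "es \<in> aperiodic_seqs G" using that mem_Union_cycles_iff[OF assms(2)] by blast
    then obtain es' where "es' \<in> aperiodic_seqs G" "rotate1 es' = es"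
      "rotation_class G es' = rotation_class G es" by (rule rotate1_preimage)
    then show ?thesis using cnt[of es'] inj_eq[OF inj_rotate1, of _ es'] by simp
  qed
  show "(\<lambda>a. rotate1 (f a)) ` arc_copies G \<nu> \<subseteq> \<Union> (set_mset M)"
  proof clarify
    fix e i assume "(e, i) \<in> arc_copies G \<nu>"
    then have "f (e, i) \<in> \<Union> (set_mset M)" using arc_labellings_image[OF assms] by blast
    then have f: "f (e, i) \<in> aperiodic_seqs G" "rotation_class G (f (e, i)) \<in># M"
      unfolding mem_Union_cycles_iff[OF assms(2)] by auto
    moreover have "rotation_class G (rotate1 (f (e, i))) = rotation_class G (f (e, i))"
      using f(1) by (intro rotation_class_rotate1) (simp add: aperiodic_seqs_def)
    ultimately show "rotate1 (f (e, i)) \<in> \<Union> (set_mset M)"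
      unfolding mem_Union_cycles_iff[OF assms(2)] by (simp add: rotate1_aperiodic_seqs)
  qed
  show "f ` arc_copies G \<nu> \<subseteq> \<Union> (set_mset M)"
    using arc_labellings_image[OF assms] by blast
qed (simp_all only: finite_arc_copies[OF assms(1)] finite_Union_cycles[OF assms(2)])

section \<open>Exchanging permutations for bijections from labelled slots\<close>

text \<open>Only the pairs are counted: since the exchange keeps the number of partners of each
  \<open>f\<close>, the number of labellings is never computed.\<close>

lemma card_labellings_with_rotating_bijections:
  assumes fin: "finite (arcs G)" and M: "M \<in> cycle_multisets G \<nu>"
  shows "card (SIGMA f:arc_labellings G \<nu> M. rotating_bijections G \<nu> f) = (\<Prod>e\<in>arcs G. fact (\<nu> e))"
proof -
  let ?E = "arc_copies G \<nu>" and ?L = "arc_labellings G \<nu> M"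
  define U where "U = \<Union> (set_mset M)"
  \<comment> \<open>One slot for each copy that \<open>M\<close> demands: a label with an index
    below its multiplicity.\<close>
  define X where "X = (SIGMA es:U. {..<count M (rotation_class G es)})"
  have ap: "set_mset M \<subseteq> aperiodic_cycles G"
    and use: "\<And>e. e \<in> arcs G \<Longrightarrow> (\<Sum>c\<in>#M. cycle_arc_count c e) = \<nu> e"
    using M by (auto simp: cycle_multisets_def)
  have finU: "finite U" unfolding U_def using ap by (rule finite_Union_cycles)
  then have finX: "finite X" by (auto simp: X_def)
  have finE: "finite ?E" using fin by (rule finite_arc_copies)
  have UP: "es \<in> aperiodic_seqs G" if "es \<in> U" for es
    using that mem_Union_cycles_iff[OF ap, folded U_def] by blast
  \<comment> \<open>Sequences outside \<open>U\<close> are included, with multiplicity zero, because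
    the fibre condition on a labelling ranges over all of \<open>aperiodic_seqs G\<close>.\<close>
  have Xfib: "card {x \<in> X. fst x = es} = count M (rotation_class G es)"
    if "es \<in> aperiodic_seqs G" for es
  proof (cases "es \<in> U")
    case True
    then have "{x \<in> X. fst x = es} = {es} \<times> {..<count M (rotation_class G es)}"
      by (auto simp: X_def)
    then show ?thesis by simp
  next
    case False
    then have "{x \<in> X. fst x = es} = {}" by (auto simp: X_def)
    moreover have "count M (rotation_class G es) = 0"
      using False that mem_Union_cycles_iff[OF ap, of es, folded U_def] by (metis not_in_iff)
    ultimately show ?thesis by (simp only: card.empty)
  qed
  \<comment> \<open>Here the prescribed arc usage of \<open>M\<close> enters.\<close>
  have Xhd: "card {x \<in> X. hd (fst x) = e} = \<nu> e" if "e \<in> arcs G" for e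
  proof -
    have "{x \<in> X. hd (fst x) = e} =
        (SIGMA es:{es \<in> U. hd es = e}. {..<count M (rotation_class G es)})"
      by (auto simp: X_def)
    then have "card {x \<in> X. hd (fst x) = e} =
        (\<Sum>es\<in>{es \<in> U. hd es = e}. count M (rotation_class G es))"
      using finU by simp
    then show ?thesis using sum_cycle_arc_count[OF ap, folded U_def] use[OF that] by simp
  qed
  have arcs_hd: "hd es \<in> arcs G" if "es \<in> aperiodic_seqs G" for es
    using that by (auto simp: aperiodic_seqs_def closed_arc_seqs_def)
  \<comment> \<open>Since \<open>g\<close> is onto the copies, the equation
    \<open>f (g x) = fst x\<close> determines \<open>f\<close>, so forgetting \<open>f\<close> is
    injective.\<close>
  have bij: "bij_betw snd (SIGMA f:?L. matching_bijections X ?E fst f)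
      (matching_bijections X ?E (\<lambda>x. hd (fst x)) fst)"
  proof (rule bij_betw_imageI)
    show "inj_on snd (SIGMA f:?L. matching_bijections X ?E fst f)"
    proof (rule inj_onI, clarsimp)
      fix f f' g
      assume f: "f \<in> ?L" "f' \<in> ?L"
        and g: "g \<in> matching_bijections X ?E fst f" "g \<in> matching_bijections X ?E fst f'"
      have "f a = f' a" if "a \<in> ?E" for a
      proof -
        obtain x where "x \<in> X" "a = g x"
          using g(1) \<open>a \<in> ?E\<close> unfolding matching_bijections_def bij_betw_def by blast
        then show ?thesis using g by (simp add: matching_bijections_def)
      qed
      then show "f = f'"
        using f by (intro PiE_ext[of f ?E "\<lambda>_. aperiodic_seqs G"]) (auto simp: arc_labellings_def)
    qed
    show "snd ` (SIGMA f:?L. matching_bijections X ?E fst f) =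
        matching_bijections X ?E (\<lambda>x. hd (fst x)) fst"
    proof (intro equalityI subsetI)
      fix g assume "g \<in> snd ` (SIGMA f:?L. matching_bijections X ?E fst f)"
      then obtain f where f: "f \<in> ?L" and g: "g \<in> matching_bijections X ?E fst f" by auto
      have "fst (g x) = hd (fst x)" if "x \<in> X" for x
      proof -
        have "g x \<in> ?E" using g that unfolding matching_bijections_def bij_betw_def by blast
        with f have "hd (f (g x)) = fst (g x)" unfolding arc_labellings_def by blast
        moreover have "f (g x) = fst x" using g that unfolding matching_bijections_def by blast
        ultimately show ?thesis by simp
      qed
      then show "g \<in> matching_bijections X ?E (\<lambda>x. hd (fst x)) fst"
        using g by (simp add: matching_bijections_def)
    next
      fix g assume g: "g \<in> matching_bijections X ?E (\<lambda>x. hd (fst x)) fst"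
      then have gb: "bij_betw g X ?E" and gh: "\<And>x. x \<in> X \<Longrightarrow> fst (g x) = hd (fst x)"
        by (auto simp: matching_bijections_def)
      \<comment> \<open>The label of a copy is read off the slot that \<open>g\<close> sends to
        it.\<close>
      define f where "f = restrict (\<lambda>a. fst (inv_into X g a)) ?E"
      have fg: "f (g x) = fst x" if "x \<in> X" for x
        using gb that by (simp add: f_def bij_betw_inv_into_left bij_betw_apply)
      have ex: "\<exists>x\<in>X. a = g x" if "a \<in> ?E" for a
        using gb that unfolding bij_betw_def by blast
      have fP: "f a \<in> aperiodic_seqs G" if "a \<in> ?E" for a
      proof -
        obtain x where "x \<in> X" "a = g x" using ex[of a] \<open>a \<in> ?E\<close> by blast
        then show ?thesis using fg UP by (auto simp: X_def)
      qed
      have fhd: "hd (f a) = fst a" if "a \<in> ?E" for a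
        using ex[OF that] fg gh by auto
      have "card {a \<in> ?E. f a = es} = count M (rotation_class G es)"
        if "es \<in> aperiodic_seqs G" for es
      proof -
        have "{a \<in> ?E. f a = es} = g ` {x \<in> X. fst x = es}"
          using ex fg bij_betw_apply[OF gb] by fastforce
        moreover have "inj_on g {x \<in> X. fst x = es}"
          using gb by (auto simp: bij_betw_def intro: inj_on_subset)
        ultimately show ?thesis using Xfib[OF that] by (simp add: card_image)
      qed
      moreover have "f \<in> ?E \<rightarrow>\<^sub>E aperiodic_seqs G"
        using fP by (intro PiE_I) (simp_all add: f_def)
      ultimately have "f \<in> ?L" using fhd by (simp add: arc_labellings_def)
      moreover have "g \<in> matching_bijections X ?E fst f"
        using g fg by (simp add: matching_bijections_def)
      ultimately show "g \<in> snd ` (SIGMA f:?L. matching_bijections X ?E fst f)" by force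
    qed
  qed
  \<comment> \<open>The codomain \<open>aperiodic_seqs G\<close> may be infinite, but all labels lie
    in the finite set \<open>U\<close>.\<close>
  have finL: "finite ?L"
  proof (rule finite_subset)
    show "?L \<subseteq> ?E \<rightarrow>\<^sub>E U"
    proof
      fix f assume f: "f \<in> ?L"
      then have "f \<in> extensional ?E" by (simp add: arc_labellings_def PiE_iff)
      with arc_labellings_image[OF fin ap f, folded U_def] show "f \<in> ?E \<rightarrow>\<^sub>E U"
        unfolding PiE_iff by blast
    qed
    show "finite (?E \<rightarrow>\<^sub>E U)" using finE finU by (simp add: finite_PiE)
  qed
  have eq: "card (rotating_bijections G \<nu> f) = card (matching_bijections X ?E fst f)"
    if f: "f \<in> ?L" for f
  proof -
    have "card (matching_bijections X ?E fst f) =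
        (\<Prod>es\<in>U. fact (count M (rotation_class G es)))"
    proof (rule card_matching_bijections[OF finX finE finU])
      show "card {a \<in> ?E. f a = es} = count M (rotation_class G es)" if "es \<in> U" for es
        using f UP[OF that] by (simp add: arc_labellings_def)
    qed (use arc_labellings_image[OF fin ap f, folded U_def] Xfib UP in \<open>auto simp: X_def\<close>)
    with card_rotating_bijections[OF fin ap f, folded U_def] show ?thesis by simp
  qed
  have "card (SIGMA f:?L. rotating_bijections G \<nu> f) =
      (\<Sum>f\<in>?L. card (rotating_bijections G \<nu> f))"
    using finL finE by (intro card_SigmaI) (auto intro: finite_matching_bijections)
  also have "\<dots> = (\<Sum>f\<in>?L. card (matching_bijections X ?E fst f))"
    using eq by simp
  also have "\<dots> = card (SIGMA f:?L. matching_bijections X ?E fst f)"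
    using finL finE finX by (intro card_SigmaI[symmetric]) (auto intro: finite_matching_bijections)
  also have "\<dots> = card (matching_bijections X ?E (\<lambda>x. hd (fst x)) fst)"
    using bij by (rule bij_betw_same_card)
  \<comment> \<open>The colours are now arcs: each arc \<open>e\<close> has \<open>\<nu> e\<close>
    copies and is the first arc of \<open>\<nu> e\<close> slots.\<close>
  also have "\<dots> = (\<Prod>e\<in>arcs G. fact (\<nu> e))"
  proof (rule card_matching_bijections[OF finX finE fin])
    show "(\<lambda>x. hd (fst x)) ` X \<subseteq> arcs G" using UP arcs_hd by (auto simp: X_def)
    show "fst ` ?E \<subseteq> arcs G" by (auto simp: arc_copies_def)
  qed (use Xhd card_arc_copies_fst in auto)
  finally show ?thesis .
qed

section \<open>Permutations determine labellings and multisets\<close>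

text \<open>Each application of \<open>\<sigma>\<close> rotates the label once, and a label starts
  with the arc of its copy. The label thus spells the arcs met along the orbit.\<close>

lemma rotating_bijection_periodic_word:
  assumes f: "f \<in> arc_labellings G \<nu> M" and \<sigma>: "\<sigma> \<in> rotating_bijections G \<nu> f"
    and a: "a \<in> arc_copies G \<nu>"
  shows "periodic_word (f a) i = fst ((\<sigma> ^^ i) a)"
proof -
  have "(\<sigma> ^^ i) a \<in> arc_copies G \<nu> \<and> f ((\<sigma> ^^ i) a) = rotate i (f a)"
  proof (induction i)
    case (Suc i)
    then have "\<sigma> ((\<sigma> ^^ i) a) \<in> arc_copies G \<nu>"
      using \<sigma> unfolding matching_bijections_def bij_betw_def by blast
    moreover have "f (\<sigma> ((\<sigma> ^^ i) a)) = rotate1 (f ((\<sigma> ^^ i) a))"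
      using \<sigma> Suc unfolding matching_bijections_def by blast
    ultimately show ?case using Suc by simp
  qed (simp add: a)
  moreover from this have "hd (f ((\<sigma> ^^ i) a)) = fst ((\<sigma> ^^ i) a)"
    using f unfolding arc_labellings_def by blast
  moreover have "f a \<noteq> []"
    using f a by (auto simp: arc_labellings_def PiE_iff dest: aperiodic_seqs_nonempty)
  ultimately show ?thesis by (simp add: hd_rotate_eq_periodic_word)
qed

text \<open>Closedness of the label \<open>f a\<close>, read at positions 0 and 1, is the required
  incidence between \<open>a\<close> and \<open>\<sigma> a\<close>.\<close>

lemma rotating_bijection_is_arc_succession:
  assumes f: "f \<in> arc_labellings G \<nu> M" and \<sigma>: "\<sigma> \<in> rotating_bijections G \<nu> f"
  shows "\<sigma> \<in> arc_successions G \<nu>"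
proof -
  have "tail G (fst (\<sigma> a)) = head G (fst a)" if a: "a \<in> arc_copies G \<nu>" for a
  proof -
    have "f a \<in> closed_arc_seqs G"
      using f a unfolding arc_labellings_def aperiodic_seqs_def by blast
    then have "head G (periodic_word (f a) 0) = tail G (periodic_word (f a) (Suc 0))"
      unfolding closed_arc_seqs_iff by blast
    then show ?thesis
      using rotating_bijection_periodic_word[OF f \<sigma> a, of 0]
        rotating_bijection_periodic_word[OF f \<sigma> a, of "Suc 0"] by simp
  qed
  with \<sigma> show ?thesis by (simp add: matching_bijections_def)
qed

text \<open>Both labels of a copy are aperiodic roots of the same orbit word, and such a root is
  unique.\<close>

lemma rotating_bijection_determines_labelling:
  assumes f: "f \<in> arc_labellings G \<nu> M" "\<sigma> \<in> rotating_bijections G \<nu> f"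
    and f': "f' \<in> arc_labellings G \<nu> M'" "\<sigma> \<in> rotating_bijections G \<nu> f'"
  shows "f = f'"
proof -
  have fP: "f \<in> arc_copies G \<nu> \<rightarrow>\<^sub>E aperiodic_seqs G" "f' \<in> arc_copies G \<nu> \<rightarrow>\<^sub>E aperiodic_seqs G"
    using f(1) f'(1) by (auto simp: arc_labellings_def)
  have "f a = f' a" if a: "a \<in> arc_copies G \<nu>" for a
  proof (rule periodic_word_inject)
    have P: "f a \<in> aperiodic_seqs G" "f' a \<in> aperiodic_seqs G"
      using fP a by blast+
    then show "f a \<noteq> []" "f' a \<noteq> []" by (auto dest: aperiodic_seqs_nonempty)
    show "seq_period (f a) = length (f a)" "seq_period (f' a) = length (f' a)"
      using P by (auto simp: aperiodic_seqs_def)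
    show "periodic_word (f a) = periodic_word (f' a)"
      using rotating_bijection_periodic_word[OF f a] rotating_bijection_periodic_word[OF f' a]
      by (intro ext) simp
  qed
  then show ?thesis using fP by (intro PiE_ext) auto
qed

text \<open>The multiplicity of a cycle is the size of the fibre over any of its
  representatives.\<close>

lemma labelling_determines_multiset:
  assumes "f \<in> arc_labellings G \<nu> M" "f \<in> arc_labellings G \<nu> M'"
    and "set_mset M \<subseteq> aperiodic_cycles G" "set_mset M' \<subseteq> aperiodic_cycles G"
  shows "M = M'"
proof (rule multiset_eqI)
  fix c
  show "count M c = count M' c"
  proof (cases "c \<in> aperiodic_cycles G")
    case True
    then obtain es where "es \<in> c" using aperiodic_cycle_nonempty by blast
    from mem_aperiodic_cycle[OF True this] show ?thesis
      using assms(1,2) by (auto simp: arc_labellings_def)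
  next
    case False
    then show ?thesis using assms(3,4) by (metis count_eq_zero_iff subsetD)
  qed
qed

text \<open>Labelling each copy by the aperiodic root of its orbit word shows that every arc
  succession comes from some \<open>M\<close> and \<open>f\<close>.\<close>

lemma ex_labelling_of_arc_succession:
  fixes G :: "('a, 'b) pre_digraph"
  assumes fin: "finite (arcs G)" and \<sigma>: "\<sigma> \<in> arc_successions G \<nu>"
  obtains M f where "M \<in> cycle_multisets G \<nu>" "f \<in> arc_labellings G \<nu> M"
    "\<sigma> \<in> rotating_bijections G \<nu> f"
proof -
  let ?E = "arc_copies G \<nu>"
  have finE: "finite ?E" using fin by (rule finite_arc_copies)
  have \<sigma>_bij: "bij_betw \<sigma> ?E ?E"
    and \<sigma>_step: "\<And>a. a \<in> ?E \<Longrightarrow> tail G (fst (\<sigma> a)) = head G (fst a)"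
    using \<sigma> by (auto simp: matching_bijections_def)
  have \<sigma>_mem: "(\<sigma> ^^ i) a \<in> ?E" if "a \<in> ?E" for a i
    using bij_betw_funpow[OF \<sigma>_bij, of i] that by (rule bij_betw_apply)
  have "\<exists>es. es \<noteq> [] \<and> seq_period es = length es \<and>
      periodic_word es = (\<lambda>i. fst ((\<sigma> ^^ i) a))" if a: "a \<in> ?E" for a
  proof -
    \<comment> \<open>The orbit returns to \<open>a\<close> itself, so its word is periodic from the
      very beginning.\<close>
    obtain p where p: "p > 0" "(\<sigma> ^^ p) a = a"
      using ex_funpow_fixpoint[OF finE \<sigma>_bij a] .
    then have "fst ((\<sigma> ^^ (i + p)) a) = fst ((\<sigma> ^^ i) a)" for i
      by (simp add: funpow_add)
    from ex_aperiodic_root[of p "\<lambda>i. fst ((\<sigma> ^^ i) a)", OF p(1) this] show ?thesis by metis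
  qed
  then obtain f0 where f0: "\<And>a. a \<in> ?E \<Longrightarrow> f0 a \<noteq> [] \<and> seq_period (f0 a) = length (f0 a) \<and>
      periodic_word (f0 a) = (\<lambda>i. fst ((\<sigma> ^^ i) a))" by metis
  define f where "f = restrict f0 ?E"
  have f: "f a \<noteq> []" "seq_period (f a) = length (f a)"
    "periodic_word (f a) i = fst ((\<sigma> ^^ i) a)" if "a \<in> ?E" for a i
    using f0[OF that] that by (simp_all add: f_def)
  have fP: "f a \<in> aperiodic_seqs G" if a: "a \<in> ?E" for a
  proof -
    have "fst ((\<sigma> ^^ i) a) \<in> arcs G" for i
      using \<sigma>_mem[OF a, of i] by (auto simp: arc_copies_def)
    moreover have "head G (fst ((\<sigma> ^^ i) a)) = tail G (fst ((\<sigma> ^^ Suc i) a))" for i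
      using \<sigma>_step[OF \<sigma>_mem[OF a, of i]] by simp
    ultimately have "f a \<in> closed_arc_seqs G"
      unfolding closed_arc_seqs_iff f(3)[OF a] using f(1)[OF a] by blast
    then show ?thesis using f(2)[OF a] by (simp add: aperiodic_seqs_def)
  qed
  \<comment> \<open>The orbit word of \<open>\<sigma> a\<close> is that of \<open>a\<close> shifted
    by one, and uniqueness of the root turns this into an equality of sequences.\<close>
  have f_\<sigma>: "f (\<sigma> a) = rotate1 (f a)" if a: "a \<in> ?E" for a
  proof (rule periodic_word_inject)
    have \<sigma>a: "\<sigma> a \<in> ?E" using \<sigma>_mem[OF a, of 1] by simp
    show "f (\<sigma> a) \<noteq> []" "rotate1 (f a) \<noteq> []" using f(1) a \<sigma>a by auto
    show "seq_period (f (\<sigma> a)) = length (f (\<sigma> a))" using f(2)[OF \<sigma>a] .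
    show "seq_period (rotate1 (f a)) = length (rotate1 (f a))"
      using rotate1_aperiodic_seqs[OF fP[OF a]] by (simp add: aperiodic_seqs_def)
    show "periodic_word (f (\<sigma> a)) = periodic_word (rotate1 (f a))"
      using periodic_word_rotate[OF f(1)[OF a], of 1] f(3)[OF a] f(3)[OF \<sigma>a]
      by (intro ext) (simp add: funpow_swap1)
  qed
  have fhd: "hd (f a) = fst a" if "a \<in> ?E" for a
    using f(1)[OF that] f(3)[OF that, of 0] by (simp add: hd_eq_periodic_word)
  \<comment> \<open>As \<open>rotate1\<close> is injective, \<open>\<sigma>\<close> carries the
    fibre over \<open>es\<close> onto the fibre over \<open>rotate1 es\<close>.\<close>
  have fib1: "card {a \<in> ?E. f a = rotate1 es} = card {a \<in> ?E. f a = es}" for es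
  proof -
    have "{a \<in> ?E. f a = rotate1 es} = \<sigma> ` {a \<in> ?E. f a = es}"
    proof (intro equalityI subsetI)
      fix b assume b: "b \<in> {a \<in> ?E. f a = rotate1 es}"
      then obtain a where a: "a \<in> ?E" "b = \<sigma> a"
        using \<sigma>_bij unfolding bij_betw_def by blast
      with b have "f a = es" using f_\<sigma>[of a] by (simp add: inj_eq[OF inj_rotate1])
      with a show "b \<in> \<sigma> ` {a \<in> ?E. f a = es}" by blast
    next
      fix b assume "b \<in> \<sigma> ` {a \<in> ?E. f a = es}"
      then show "b \<in> {a \<in> ?E. f a = rotate1 es}"
        using f_\<sigma> bij_betw_apply[OF \<sigma>_bij] by blast
    qed
    moreover have "inj_on \<sigma> {a \<in> ?E. f a = es}"
      using \<sigma>_bij by (auto simp: bij_betw_def intro: inj_on_subset)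
    ultimately show ?thesis by (simp add: card_image)
  qed
  have fib: "card {a \<in> ?E. f a = rotate k es} = card {a \<in> ?E. f a = es}" for k es
    by (induction k) (simp_all add: fib1)
  \<comment> \<open>Only copies labelled by a chosen representative contribute to \<open>M\<close>.
    Counting all copies would count each cycle once for every rotation.\<close>
  define rep where "rep c = (SOME es. es \<in> c)" for c :: "'b list set"
  define M where "M = image_mset (\<lambda>a. rotation_class G (f a))
    (mset_set {a \<in> ?E. f a = rep (rotation_class G (f a))})"
  have ap: "set_mset M \<subseteq> aperiodic_cycles G"
    using finE fP by (auto simp: M_def intro: rotation_class_mem_aperiodic_cycles)
  have "card {a \<in> ?E. f a = es} = count M (rotation_class G es)" if es: "es \<in> aperiodic_seqs G" for es
  proof -
    let ?c = "rotation_class G es"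
    have c: "?c \<in> aperiodic_cycles G" using es by (rule rotation_class_mem_aperiodic_cycles)
    then have rep: "rep ?c \<in> ?c"
      unfolding rep_def using aperiodic_cycle_nonempty some_in_eq by blast
    have rep_iff: "f a = rep ?c \<longleftrightarrow>
        f a = rep (rotation_class G (f a)) \<and> rotation_class G (f a) = ?c" for a
      using mem_aperiodic_cycle(2)[OF c rep] by metis
    obtain k where "rep ?c = rotate k es"
      using rep es rotation_class_eq[of es G] by (auto simp: aperiodic_seqs_def)
    then have "card {a \<in> ?E. f a = es} = card {a \<in> ?E. f a = rep ?c}"
      using fib by simp
    also have "{a \<in> ?E. f a = rep ?c} =
        {a \<in> {a \<in> ?E. f a = rep (rotation_class G (f a))}. rotation_class G (f a) = ?c}"
      using rep_iff by blast
    also have "card \<dots> = count M ?c"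
      unfolding M_def count_image_mset' using finE by (simp add: eq_commute)
    finally show ?thesis .
  qed
  moreover have "f \<in> ?E \<rightarrow>\<^sub>E aperiodic_seqs G"
    using fP by (intro PiE_I) (simp_all add: f_def)
  ultimately have lab: "f \<in> arc_labellings G \<nu> M"
    using fhd by (simp add: arc_labellings_def)
  have "\<sigma> \<in> rotating_bijections G \<nu> f"
    using \<sigma> f_\<sigma> by (simp add: matching_bijections_def)
  with arc_labellings_imp_cycle_multisets[OF fin ap lab] lab show thesis by (rule that)
qed

section \<open>Counting triples of multiset, labelling and permutation\<close>

theorem theorem12:
  fixes G :: "('a, 'b) pre_digraph" and \<nu> :: "'b \<Rightarrow> nat"
  assumes "fin_digraph G"
    and "\<And>x. x \<in> verts G \<Longrightarrow> weighted_indeg G x \<nu> = weighted_outdeg G x \<nu>"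
  shows "real (card (cycle_multisets G \<nu>)) =
    (\<Prod>x\<in>verts G. fact (weighted_outdeg G x \<nu>)) / (\<Prod>e\<in>arcs G. fact (\<nu> e))"
proof -
  interpret fin_digraph G by (rule assms(1))
  let ?D = "\<lambda>M. SIGMA f:arc_labellings G \<nu> M. rotating_bijections G \<nu> f"
  let ?T = "SIGMA M:cycle_multisets G \<nu>. ?D M"
  have ap: "set_mset M \<subseteq> aperiodic_cycles G" if "M \<in> cycle_multisets G \<nu>" for M
    using that by (simp add: cycle_multisets_def)
  \<comment> \<open>A permutation determines \<open>f\<close>, and \<open>f\<close> determines
    \<open>M\<close>, so forgetting both is injective.\<close>
  have bij: "bij_betw (\<lambda>(M, f, \<sigma>). \<sigma>) ?T (arc_successions G \<nu>)"
  proof (rule bij_betw_imageI)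
    show "inj_on (\<lambda>(M, f, \<sigma>). \<sigma>) ?T"
      by (rule inj_onI, clarsimp)
        (metis rotating_bijection_determines_labelling labelling_determines_multiset ap)
    show "(\<lambda>(M, f, \<sigma>). \<sigma>) ` ?T = arc_successions G \<nu>"
    proof (intro equalityI subsetI)
      fix \<sigma> assume "\<sigma> \<in> arc_successions G \<nu>"
      then obtain M f where "M \<in> cycle_multisets G \<nu>" "f \<in> arc_labellings G \<nu> M"
        "\<sigma> \<in> rotating_bijections G \<nu> f"
        by (rule ex_labelling_of_arc_succession[OF finite_arcs])
      then have "(M, f, \<sigma>) \<in> ?T" by simp
      then show "\<sigma> \<in> (\<lambda>(M, f, \<sigma>). \<sigma>) ` ?T" by force
    next
      fix \<sigma> assume "\<sigma> \<in> (\<lambda>(M, f, \<sigma>). \<sigma>) ` ?T"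
      then obtain M f where "f \<in> arc_labellings G \<nu> M" "\<sigma> \<in> rotating_bijections G \<nu> f" by auto
      then show "\<sigma> \<in> arc_successions G \<nu>" by (rule rotating_bijection_is_arc_succession)
    qed
  qed
  have finT: "finite ?T"
    using bij_betw_finite[OF bij] finite_matching_bijections finite_arc_copies[OF finite_arcs]
    by blast
  have cardD: "card (?D M) = (\<Prod>e\<in>arcs G. fact (\<nu> e))" if "M \<in> cycle_multisets G \<nu>" for M
    using card_labellings_with_rotating_bijections[OF finite_arcs that] .
  have pos: "(\<Prod>e\<in>arcs G. fact (\<nu> e)) > (0::nat)" by (simp add: prod_pos)
  have neD: "?D M \<noteq> {}" "finite (?D M)" if "M \<in> cycle_multisets G \<nu>" for M
  proof -
    have "card (?D M) > 0" using cardD[OF that] pos by metis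
    then show "?D M \<noteq> {}" "finite (?D M)" unfolding card_gt_0_iff by blast+
  qed
  \<comment> \<open>Every \<open>M\<close> extends to a triple, so finiteness of the set of
    multisets follows by projecting the finite set \<open>?T\<close>.\<close>
  have "fst ` ?T = cycle_multisets G \<nu>"
    unfolding fst_image_Sigma using neD(1) by blast
  then have fin: "finite (cycle_multisets G \<nu>)"
    using finite_imageI[OF finT, of fst] by (simp only:)
  have "(\<Prod>x\<in>verts G. fact (weighted_outdeg G x \<nu>)) = card ?T"
    using bij_betw_same_card[OF bij] card_arc_successions[OF assms] by (simp only:)
  also have "\<dots> = (\<Sum>M\<in>cycle_multisets G \<nu>. card (?D M))"
    using fin neD(2) by (intro card_SigmaI) auto
  also have "\<dots> = card (cycle_multisets G \<nu>) * (\<Prod>e\<in>arcs G. fact (\<nu> e))"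
    by (simp only: cardD sum_constant of_nat_id cong: sum.cong)
  finally have "real (\<Prod>x\<in>verts G. fact (weighted_outdeg G x \<nu>)) =
      real (card (cycle_multisets G \<nu>)) * real (\<Prod>e\<in>arcs G. fact (\<nu> e))"
    by (simp only: of_nat_mult)
  then show ?thesis
    by (simp add: field_simps)
qed

end
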